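(* Let $p\in\mathbb{N}$ and let $(X_t)_{t\in\mathbb{N}}$ be an order-$p$ parametric autoregressive time series with parameter space $\mathbb{T}$, as described in the context. Let $\mathbb{T}_0\subset\mathbb{T}$ be a (nonempty) null parameter set. Let $(\hat\Theta_T)_{T\ge p}$ be a non-anticipatory sequence of $\mathbb{T}$-valued estimators, i.e. for each $T$, $\hat\Theta_T$ is a (measurable) function of $(X_1,\dots,X_T)$ only. For $\theta\in\mathbb{T}$ define $M_T(\theta)=1$ for $0\le T\le p$ and $$M_T(\theta)=\frac{\prod_{t=p+1}^{T} f\left(X_t\mid X_{t-p},\dots,X_{t-1};\hat\Theta_{t-1}\right)}{\prod_{t=p+1}^{T} f\left(X_t\mid X_{t-p},\dots,X_{t-1};\theta\right)}\qquad\text{for } T\ge p+1.$$ For each $T\ge p+1$ let $\tilde\Theta_T$ be a (measurable) estimator computed from $(X_1,\dots,X_T)$ such that $$\tilde\Theta_T\in\left\{\tilde\theta\in\mathbb{T}_0:\prod_{t=p+1}^{T} f\left(X_t\mid X_{t-p},\dots,X_{t-1};\tilde\theta\right)\ge\prod_{t=p+1}^{T} f\left(X_t\mid X_{t-p},\dots,X_{t-1};\theta\right)\ \text{for all }\theta\in\mathbb{T}_0\right\},$$ and define $N_T=M_T(\tilde\Theta_T)$ for $T\ge p+1$ and $N_T=1$ for $0\le T\le p$. Then for every $\alpha\in(0,1)$, $$\sup_{\theta\in\mathbb{T}_0}\mathrm{Pr}_{\theta}\left(\sup_{T\ge 0}N_T\ge 1/\alpha\right)\le\alpha.$$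
   Context: Setting. $\mathbb{X}$ is a measurable space with a $\sigma$-finite reference measure, written $\mathrm{d}x$; $\mathbb{T}$ is a measurable parameter space. For each $\theta\in\mathbb{T}$ there are given a probability density function (PDF) $f(x_1,\dots,x_p;\theta)$ on $\mathbb{X}^p$ (with respect to the product reference measure) and a conditional PDF $f(x\mid z;\theta)\ge 0$, $x\in\mathbb{X}$, $z\in\mathbb{X}^p$, with $\int_{\mathbb{X}} f(x\mid z;\theta)\,\mathrm{d}x=1$ for every $z\in\mathbb{X}^p$. The densities are jointly measurable in all arguments, including $\theta$. $\mathrm{Pr}_\theta$ denotes the probability measure under which $(X_1,\dots,X_p)$ has PDF $f(\cdot;\theta)$ and, for each $t>p$, the conditional law of $X_t$ given $\mathcal{F}_{t-1}=\sigma(X_1,\dots,X_{t-1})$ has PDF $f(\cdot\mid X_{t-p},\dots,X_{t-1};\theta)$. Equivalently, for every $T>p$, $(X_1,\dots,X_T)$ has joint PDF $$f(x_1,\dots,x_p;\theta)\prod_{t=p+1}^{T} f(x_t\mid x_{t-p},\dots,x_{t-1};\theta).$$ Convention: a likelihood ratio with zero denominator is assigned the value $+\infty$ (for $M_T(\theta)$ this happens with $\mathrm{Pr}_\theta$-probability zero). *)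

theory Defs
  imports "HOL-Probability.Probability"
begin

text \<open>
  Time runs over the positive natural numbers, so a data path is a function \<open>x :: nat \<Rightarrow> 'a\<close> of
  which only the values at \<open>1, 2, \<dots>\<close> matter. Elements of the \<open>p\<close>-fold product of the observation
  space are extensional functions on \<open>{..<p}\<close>, listed in chronological order, so that
  \<open>window p x t\<close> is \<open>(x\<^bsub>t-p\<^esub>, \<dots>, x\<^bsub>t-1\<^esub>)\<close>. In particular \<open>window p x (p + 1)\<close> is
  \<open>(x\<^bsub>1\<^esub>, \<dots>, x\<^bsub>p\<^esub>)\<close>.
\<close>

definition window :: "nat \<Rightarrow> (nat \<Rightarrow> 'a) \<Rightarrow> nat \<Rightarrow> nat \<Rightarrow> 'a" where
  "window p x t = (\<lambda>i\<in>{..<p}. x (t - p + i))"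

definition cond_likelihood ::
  "nat \<Rightarrow> ('b \<Rightarrow> (nat \<Rightarrow> 'a) \<Rightarrow> 'a \<Rightarrow> real) \<Rightarrow> 'b \<Rightarrow> (nat \<Rightarrow> 'a) \<Rightarrow> nat \<Rightarrow> real" where
  "cond_likelihood p f \<theta> x T = (\<Prod>t\<in>{p + 1..T}. f \<theta> (window p x t) (x t))"

text \<open>
  The measurable space \<open>Par\<close> is the parameter space, \<open>f0 \<theta>\<close> is the density of the first \<open>p\<close>
  observations and \<open>f \<theta> z\<close> is the conditional density given that the last \<open>p\<close> observations
  were \<open>z\<close>.
\<close>

locale autoregressive_model = sigma_finite_measure M for M :: "'a measure" +
  fixes p :: nat
    and Par :: "'b measure"
    and f0 :: "'b \<Rightarrow> (nat \<Rightarrow> 'a) \<Rightarrow> real"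
    and f :: "'b \<Rightarrow> (nat \<Rightarrow> 'a) \<Rightarrow> 'a \<Rightarrow> real"
  assumes f0_measurable:
      "(\<lambda>(\<theta>, z). f0 \<theta> z) \<in> borel_measurable (Par \<Otimes>\<^sub>M PiM {..<p} (\<lambda>_. M))"
    and f0_nonneg:
      "\<And>\<theta> z. \<theta> \<in> space Par \<Longrightarrow> z \<in> space (PiM {..<p} (\<lambda>_. M)) \<Longrightarrow> 0 \<le> f0 \<theta> z"
    and f0_integral:
      "\<And>\<theta>. \<theta> \<in> space Par \<Longrightarrow> (\<integral>\<^sup>+ z. ennreal (f0 \<theta> z) \<partial>PiM {..<p} (\<lambda>_. M)) = 1"
    and f_measurable:
      "(\<lambda>(\<theta>, z, x). f \<theta> z x) \<in> borel_measurable (Par \<Otimes>\<^sub>M (PiM {..<p} (\<lambda>_. M) \<Otimes>\<^sub>M M))"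
    and f_nonneg:
      "\<And>\<theta> z x. \<theta> \<in> space Par \<Longrightarrow> z \<in> space (PiM {..<p} (\<lambda>_. M)) \<Longrightarrow> x \<in> space M \<Longrightarrow> 0 \<le> f \<theta> z x"
    and f_integral:
      "\<And>\<theta> z. \<theta> \<in> space Par \<Longrightarrow> z \<in> space (PiM {..<p} (\<lambda>_. M)) \<Longrightarrow> (\<integral>\<^sup>+ x. ennreal (f \<theta> z x) \<partial>M) = 1"

text \<open>
  The probability measures \<open>P \<theta>\<close> live on one common measurable space \<open>\<Omega>\<close> that carries the
  observations \<open>X 1, X 2, \<dots>\<close>; the measure of \<open>\<Omega>\<close> itself plays no role.
\<close>

locale autoregressive_series = autoregressive_model M p Par f0 f
  for M :: "'a measure" and p :: nat and Par :: "'b measure"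
    and f0 :: "'b \<Rightarrow> (nat \<Rightarrow> 'a) \<Rightarrow> real" and f :: "'b \<Rightarrow> (nat \<Rightarrow> 'a) \<Rightarrow> 'a \<Rightarrow> real" +
  fixes \<Omega> :: "'w measure"
    and P :: "'b \<Rightarrow> 'w measure"
    and X :: "nat \<Rightarrow> 'w \<Rightarrow> 'a"
  assumes X_measurable: "\<And>t. 1 \<le> t \<Longrightarrow> X t \<in> measurable \<Omega> M"
    and sets_P: "\<And>\<theta>. \<theta> \<in> space Par \<Longrightarrow> sets (P \<theta>) = sets \<Omega>"
    and prob_space_P: "\<And>\<theta>. \<theta> \<in> space Par \<Longrightarrow> prob_space (P \<theta>)"
    and joint_density:
      "\<And>\<theta> T. \<theta> \<in> space Par \<Longrightarrow> p < T \<Longrightarrow>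
        distributed (P \<theta>) (PiM {1..T} (\<lambda>_. M)) (\<lambda>\<omega>. \<lambda>t\<in>{1..T}. X t \<omega>)
          (\<lambda>x. ennreal (f0 \<theta> (window p x (p + 1)) * cond_likelihood p f \<theta> x T))"

text \<open>
  An estimator based on \<open>T\<close> observations is a map on the \<open>T\<close>-fold product of the observation
  space, so it can only depend on the data up to time \<open>T\<close>.
\<close>

definition estimator :: "'a measure \<Rightarrow> 'b measure \<Rightarrow> nat \<Rightarrow> ((nat \<Rightarrow> 'a) \<Rightarrow> 'b) \<Rightarrow> bool" where
  "estimator M Par T e \<longleftrightarrow> e \<in> measurable (PiM {1..T} (\<lambda>_. M)) Par"

definition estimate :: "(nat \<Rightarrow> (nat \<Rightarrow> 'a) \<Rightarrow> 'b) \<Rightarrow> nat \<Rightarrow> (nat \<Rightarrow> 'a) \<Rightarrow> 'b" where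
  "estimate e T x = e T (restrict x {1..T})"

definition max_likelihood_set ::
  "nat \<Rightarrow> ('b \<Rightarrow> (nat \<Rightarrow> 'a) \<Rightarrow> 'a \<Rightarrow> real) \<Rightarrow> 'b set \<Rightarrow> (nat \<Rightarrow> 'a) \<Rightarrow> nat \<Rightarrow> 'b set" where
  "max_likelihood_set p f \<Theta>0 x T =
    {\<theta>' \<in> \<Theta>0. \<forall>\<theta>\<in>\<Theta>0. cond_likelihood p f \<theta>' x T \<ge> cond_likelihood p f \<theta> x T}"

text \<open>
  A ratio with zero denominator is \<open>\<infinity>\<close>, even if the numerator vanishes too; the division of
  \<^typ>\<open>ennreal\<close> would give \<open>0 / 0 = 0\<close>.
\<close>

definition likelihood_ratio :: "real \<Rightarrow> real \<Rightarrow> ennreal" where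
  "likelihood_ratio a b = (if b = 0 then \<infinity> else ennreal (a / b))"

definition M_process ::
  "nat \<Rightarrow> ('b \<Rightarrow> (nat \<Rightarrow> 'a) \<Rightarrow> 'a \<Rightarrow> real) \<Rightarrow> (nat \<Rightarrow> (nat \<Rightarrow> 'a) \<Rightarrow> 'b) \<Rightarrow> 'b \<Rightarrow> (nat \<Rightarrow> 'a) \<Rightarrow> nat \<Rightarrow> ennreal"
  where
  "M_process p f \<theta>hat \<theta> x T =
    (if T \<le> p then 1
     else likelihood_ratio
            (\<Prod>t\<in>{p + 1..T}. f (estimate \<theta>hat (t - 1) x) (window p x t) (x t))
            (cond_likelihood p f \<theta> x T))"

definition N_process ::
  "nat \<Rightarrow> ('b \<Rightarrow> (nat \<Rightarrow> 'a) \<Rightarrow> 'a \<Rightarrow> real) \<Rightarrow> (nat \<Rightarrow> (nat \<Rightarrow> 'a) \<Rightarrow> 'b) \<Rightarrow> (nat \<Rightarrow> (nat \<Rightarrow> 'a) \<Rightarrow> 'b)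
    \<Rightarrow> (nat \<Rightarrow> 'a) \<Rightarrow> nat \<Rightarrow> ennreal"
  where
  "N_process p f \<theta>hat \<theta>tilde x T =
    (if T \<le> p then 1 else M_process p f \<theta>hat (estimate \<theta>tilde T x) x T)"

end

theory Submission
  imports Defs
begin

text \<open>
  Along the data, the maximum likelihood estimate makes the denominator of \<open>N_process\<close> at least the
  likelihood of any null parameter \<open>\<theta>\<close>, so \<open>N_process\<close> is dominated by \<open>M_process\<close> at \<open>\<theta>\<close>, and the
  claim reduces to Ville's inequality for the latter under \<open>P \<theta>\<close>. The numerator of \<open>M_process\<close>
  times \<open>f0 \<theta>\<close> is again a consistent family of densities of total mass one. On the event that the
  level \<open>c\<close> is first crossed at time \<open>n\<close>, this density is at least \<open>c\<close> times the density of the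
  data under \<open>P \<theta>\<close>; integrating out later observations preserves that comparison on the event.
\<close>

section \<open>Predictive likelihoods and their dependence on the past\<close>

text \<open>The numerator of \<open>M_process\<close>. Isolating it lets numerator and denominator
  share one set of lemmas, since a constant estimator turns it into
  \<open>cond_likelihood\<close>.\<close>

definition plugin_likelihood ::
  "nat \<Rightarrow> ('b \<Rightarrow> (nat \<Rightarrow> 'a) \<Rightarrow> 'a \<Rightarrow> real) \<Rightarrow> (nat \<Rightarrow> (nat \<Rightarrow> 'a) \<Rightarrow> 'b) \<Rightarrow> (nat \<Rightarrow> 'a) \<Rightarrow> nat \<Rightarrow> real" where
  "plugin_likelihood p f e x T = (\<Prod>t\<in>{p + 1..T}. f (estimate e (t - 1) x) (window p x t) (x t))"

lemma cond_likelihood_eq_plugin: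
  "cond_likelihood p f \<theta> = plugin_likelihood p f (\<lambda>_ _. \<theta>)"
  by (simp add: fun_eq_iff cond_likelihood_def plugin_likelihood_def estimate_def)

lemma M_process_eq:
  "p < T \<Longrightarrow> M_process p f e \<theta> x T =
    likelihood_ratio (plugin_likelihood p f e x T) (cond_likelihood p f \<theta> x T)"
  by (simp add: M_process_def plugin_likelihood_def)

lemma plugin_likelihood_Suc:
  assumes "p \<le> n"
  shows "plugin_likelihood p f e x (Suc n) =
    plugin_likelihood p f e x n * f (estimate e n x) (window p x (Suc n)) (x (Suc n))"
proof -
  have "{p + 1..Suc n} = insert (Suc n) {p + 1..n}" using assms by auto
  then show ?thesis by (simp add: plugin_likelihood_def mult.commute)
qed

text \<open>The indices \<open>t - p + i\<close> run from \<open>t - p\<close>, which is at least 1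
  because \<open>p < t\<close>, up to \<open>t - 1\<close>. Hence agreement up to \<open>n\<close>
  still suffices at time \<open>Suc n\<close>.\<close>

lemma window_cong:
  assumes "\<And>s. 1 \<le> s \<Longrightarrow> s \<le> n \<Longrightarrow> x s = y s" and "p < t" "t \<le> Suc n"
  shows "window p x t = window p y t"
  using assms by (auto simp: window_def fun_eq_iff restrict_def)

lemma estimate_cong:
  assumes "\<And>s. 1 \<le> s \<Longrightarrow> s \<le> n \<Longrightarrow> x s = y s" and "t \<le> n"
  shows "estimate e t x = estimate e t y"
proof -
  have "restrict x {1..t} = restrict y {1..t}" using assms by (auto simp: restrict_def)
  then show ?thesis by (simp add: estimate_def)
qed

text \<open>Non-anticipation: the factor at time \<open>t\<close> reads the data up to
  \<open>t\<close> and its parameter only the data up to \<open>t - 1\<close>. This permits passing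
  between a path, its restriction and an update at a later time.\<close>

lemma plugin_likelihood_cong:
  assumes xy: "\<And>s. 1 \<le> s \<Longrightarrow> s \<le> n \<Longrightarrow> x s = y s" and "T \<le> n"
  shows "plugin_likelihood p f e x T = plugin_likelihood p f e y T"
  unfolding plugin_likelihood_def
proof (rule prod.cong[OF refl])
  fix t assume t: "t \<in> {p + 1..T}"
  have "window p x t = window p y t" "estimate e (t - 1) x = estimate e (t - 1) y"
    using t assms(2) by (auto intro!: window_cong[where n = n] estimate_cong[where n = n] xy)
  then show "f (estimate e (t - 1) x) (window p x t) (x t) =
      f (estimate e (t - 1) y) (window p y t) (y t)"
    using xy[of t] t assms(2) by simp
qed

lemma M_process_cong:
  assumes "\<And>s. 1 \<le> s \<Longrightarrow> s \<le> n \<Longrightarrow> x s = y s" and "T \<le> n"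
  shows "M_process p f e \<theta> x T = M_process p f e \<theta> y T"
proof -
  have "plugin_likelihood p f e x T = plugin_likelihood p f e y T" for e
    by (rule plugin_likelihood_cong[where n = n]) (use assms in auto)
  then show ?thesis
    by (cases "p < T") (simp_all add: M_process_eq cond_likelihood_eq_plugin, simp add: M_process_def)
qed

section \<open>Ratios with a possibly vanishing denominator\<close>

text \<open>The convention at zero is what makes this hold throughout: if \<open>b' = 0\<close> the
  right side is infinite, and \<open>b = 0\<close> forces \<open>b' = 0\<close>.\<close>

lemma likelihood_ratio_antimono:
  assumes "0 \<le> a" "0 \<le> b'" "b' \<le> b"
  shows "likelihood_ratio a b \<le> likelihood_ratio a b'"
  using assms by (auto simp: likelihood_ratio_def intro!: ennreal_leI divide_left_mono)

text \<open>Clears the denominator. For \<open>b = 0\<close> the ratio is infinite, but the claim is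
  then just \<open>0 \<le> a\<close>.\<close>

lemma likelihood_ratio_less_imp:
  assumes "0 \<le> a" "0 \<le> b" "0 \<le> c" and "ennreal c < likelihood_ratio a b"
  shows "c * b \<le> a"
  using assms by (cases "b = 0") (auto simp: likelihood_ratio_def ennreal_less_iff field_simps)

section \<open>Measurability and sign of the likelihoods\<close>

context autoregressive_model
begin

lemma window_measurable:
  assumes "p < t" "t \<le> Suc n"
  shows "(\<lambda>x. window p x t) \<in> measurable (PiM {1..n} (\<lambda>_. M)) (PiM {..<p} (\<lambda>_. M))"
  unfolding window_def
  by (rule measurable_restrict) (use assms in \<open>auto intro!: measurable_component_singleton\<close>)

lemma estimate_measurable:
  assumes "estimator M Par t (e t)" "t \<le> n"
  shows "estimate e t \<in> measurable (PiM {1..n} (\<lambda>_. M)) Par"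
proof -
  have "(\<lambda>x. restrict x {1..t}) \<in> measurable (PiM {1..n} (\<lambda>_. M)) (PiM {1..t} (\<lambda>_. M))"
    by (rule measurable_restrict_subset) (use assms(2) in auto)
  from measurable_compose[OF this assms(1)[unfolded estimator_def]]
  show ?thesis by (simp add: estimate_def[abs_def])
qed

lemma factor_measurable:
  assumes "estimator M Par (t - 1) (e (t - 1))" "p < t" "t \<le> n"
  shows "(\<lambda>x. f (estimate e (t - 1) x) (window p x t) (x t))
    \<in> borel_measurable (PiM {1..n} (\<lambda>_. M))"
proof -
  have "(\<lambda>x. (estimate e (t - 1) x, window p x t, x t))
      \<in> measurable (PiM {1..n} (\<lambda>_. M)) (Par \<Otimes>\<^sub>M (PiM {..<p} (\<lambda>_. M) \<Otimes>\<^sub>M M))"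
    using assms by (intro measurable_Pair estimate_measurable window_measurable
        measurable_component_singleton) auto
  from measurable_compose[OF this f_measurable] show ?thesis by simp
qed

lemma factor_nonneg:
  assumes "x \<in> space (PiM {1..n} (\<lambda>_. M))"
    and "estimator M Par (t - 1) (e (t - 1))" "p < t" "t \<le> n"
  shows "0 \<le> f (estimate e (t - 1) x) (window p x t) (x t)"
proof (rule f_nonneg)
  show "estimate e (t - 1) x \<in> space Par"
    using assms by (intro measurable_space[OF estimate_measurable]) auto
  show "window p x t \<in> space (PiM {..<p} (\<lambda>_. M))"
    using assms by (intro measurable_space[OF window_measurable]) auto
  show "x t \<in> space M"
    using assms by (auto simp: space_PiM PiE_iff)
qed

lemma plugin_likelihood_measurable:
  assumes "\<And>t. p \<le> t \<Longrightarrow> estimator M Par t (e t)" "T \<le> n"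
  shows "(\<lambda>x. plugin_likelihood p f e x T) \<in> borel_measurable (PiM {1..n} (\<lambda>_. M))"
  unfolding plugin_likelihood_def
  by (rule borel_measurable_prod, rule factor_measurable) (use assms in auto)

lemma plugin_likelihood_nonneg:
  assumes "x \<in> space (PiM {1..n} (\<lambda>_. M))"
    and "\<And>t. p \<le> t \<Longrightarrow> estimator M Par t (e t)" "T \<le> n"
  shows "0 \<le> plugin_likelihood p f e x T"
  unfolding plugin_likelihood_def
  by (intro prod_nonneg factor_nonneg[OF assms(1)]) (use assms in auto)

lemma const_estimator: "\<theta> \<in> space Par \<Longrightarrow> estimator M Par t (\<lambda>_. \<theta>)"
  by (simp add: estimator_def)

lemma initial_density_measurable:
  assumes "\<theta> \<in> space Par" "p \<le> n"
  shows "(\<lambda>x. f0 \<theta> (window p x (p + 1))) \<in> borel_measurable (PiM {1..n} (\<lambda>_. M))"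
proof -
  have "(\<lambda>x. (\<theta>, window p x (p + 1)))
      \<in> measurable (PiM {1..n} (\<lambda>_. M)) (Par \<Otimes>\<^sub>M PiM {..<p} (\<lambda>_. M))"
    using assms by (intro measurable_Pair window_measurable) auto
  from measurable_compose[OF this f0_measurable] show ?thesis by simp
qed

lemma initial_density_nonneg:
  assumes "x \<in> space (PiM {1..n} (\<lambda>_. M))" "\<theta> \<in> space Par" "p \<le> n"
  shows "0 \<le> f0 \<theta> (window p x (p + 1))"
  using assms by (intro f0_nonneg measurable_space[OF window_measurable]) auto

section \<open>Joint densities and integrating out the latest observation\<close>

text \<open>Joint density of \<open>n\<close> observations when the first \<open>p\<close> have
  density \<open>f0 \<theta>\<close> and each later one follows the conditional density at the
  current estimate. For \<open>n > p\<close>, the constant estimator \<open>\<theta>\<close> gives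
  the density under \<open>P \<theta>\<close>. The initial factor is the same for all
  \<open>e\<close>, so two such densities compare as their plug-in likelihoods do.\<close>

definition path_density :: "'b \<Rightarrow> (nat \<Rightarrow> (nat \<Rightarrow> 'a) \<Rightarrow> 'b) \<Rightarrow> nat \<Rightarrow> (nat \<Rightarrow> 'a) \<Rightarrow> ennreal" where
  "path_density \<theta> e n x = ennreal (f0 \<theta> (window p x (p + 1)) * plugin_likelihood p f e x n)"

lemma path_density_measurable:
  assumes "\<theta> \<in> space Par" "\<And>t. p \<le> t \<Longrightarrow> estimator M Par t (e t)" "p \<le> n"
  shows "path_density \<theta> e n \<in> borel_measurable (PiM {1..n} (\<lambda>_. M))"
  unfolding path_density_def[abs_def]
  by (intro measurable_compose[OF _ measurable_ennreal] borel_measurable_times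
      initial_density_measurable plugin_likelihood_measurable assms) auto

text \<open>At time \<open>p\<close> the product is empty and no estimate has entered. This ties the
  total mass for every estimator to that of the model.\<close>

lemma path_density_start: "path_density \<theta> e p x = path_density \<theta> e' p x"
  by (simp add: path_density_def plugin_likelihood_def)

text \<open>Once the first \<open>n\<close> observations are fixed, so are the estimate and the
  window, and the new factor is a conditional density in the last coordinate, of integral one. An
  event of the first \<open>n\<close> observations passes through as a constant.\<close>

lemma nn_integral_path_density_Suc:
  assumes \<theta>: "\<theta> \<in> space Par" and e: "\<And>t. p \<le> t \<Longrightarrow> estimator M Par t (e t)" and n: "p \<le> n"
    and B: "Measurable.pred (PiM {1..n} (\<lambda>_. M)) B"
  shows "(\<integral>\<^sup>+x. path_density \<theta> e (Suc n) x * indicator {x. B (restrict x {1..n})} x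
            \<partial>PiM {1..Suc n} (\<lambda>_. M)) =
    (\<integral>\<^sup>+x. path_density \<theta> e n x * indicator {x. B x} x \<partial>PiM {1..n} (\<lambda>_. M))"
proof -
  interpret S: product_sigma_finite "\<lambda>_::nat. M"
    by unfold_locales
  have ins: "{1..Suc n} = insert (Suc n) {1..n}" by auto
  have res: "(\<lambda>x. restrict x {1..n})
      \<in> measurable (PiM {1..Suc n} (\<lambda>_. M)) (PiM {1..n} (\<lambda>_. M))"
    by (rule measurable_restrict_subset) auto
  have "(\<lambda>x. path_density \<theta> e (Suc n) x * indicator {x. B (restrict x {1..n})} x)
      \<in> borel_measurable (PiM {1..Suc n} (\<lambda>_. M))"
    using measurable_compose[OF res B] \<theta> e n
    by (intro borel_measurable_times_ennreal path_density_measurable borel_measurable_indicator') auto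
  \<comment> \<open>Tonelli, with the coordinate \<open>Suc n\<close> integrated innermost.\<close>
  then have "(\<integral>\<^sup>+x. path_density \<theta> e (Suc n) x * indicator {x. B (restrict x {1..n})} x
            \<partial>PiM {1..Suc n} (\<lambda>_. M)) =
    (\<integral>\<^sup>+x. (\<integral>\<^sup>+y. path_density \<theta> e (Suc n) (x(Suc n := y)) *
        indicator {x. B (restrict x {1..n})} (x(Suc n := y)) \<partial>M) \<partial>PiM {1..n} (\<lambda>_. M))"
    unfolding ins by (intro S.product_nn_integral_insert) auto
  also have "\<dots> = (\<integral>\<^sup>+x. path_density \<theta> e n x * indicator {x. B x} x \<partial>PiM {1..n} (\<lambda>_. M))"
  proof (rule nn_integral_cong)
    fix x assume x: "x \<in> space (PiM {1..n} (\<lambda>_. M))"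
    have est: "estimate e n x \<in> space Par"
      by (rule measurable_space[OF estimate_measurable[OF e] x]) (use n in auto)
    have win: "window p x (Suc n) \<in> space (PiM {..<p} (\<lambda>_. M))"
      by (rule measurable_space[OF window_measurable x]) (use n in auto)
    have "path_density \<theta> e (Suc n) (x(Suc n := y)) *
        indicator {x. B (restrict x {1..n})} (x(Suc n := y)) =
      path_density \<theta> e n x * indicator {x. B x} x *
        ennreal (f (estimate e n x) (window p x (Suc n)) y)" if y: "y \<in> space M" for y
    proof -
      let ?x = "x(Suc n := y)"
      have eq: "?x s = x s" if "1 \<le> s" "s \<le> n" for s using that by simp
      \<comment> \<open>Points of the product are extensional, so dropping the updated coordinate
        returns \<open>x\<close> itself.\<close>
      have "restrict ?x {1..n} = x"
        using x by (auto simp: space_PiM PiE_iff fun_eq_iff restrict_def extensional_def)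
      moreover have "window p ?x (p + 1) = window p x (p + 1)"
        "window p ?x (Suc n) = window p x (Suc n)"
        using n by (auto intro!: window_cong[where n = n])
      moreover have "estimate e n ?x = estimate e n x"
        by (rule estimate_cong[where n = n]) auto
      moreover have "plugin_likelihood p f e ?x n = plugin_likelihood p f e x n"
        by (rule plugin_likelihood_cong[where n = n]) auto
      \<comment> \<open>\<open>ennreal\<close> sends negative reals to 0, so splitting it over the
        product uses the signs of the factors.\<close>
      moreover have "0 \<le> f0 \<theta> (window p x (p + 1)) * plugin_likelihood p f e x n"
        using initial_density_nonneg[OF x \<theta> n] plugin_likelihood_nonneg[OF x e] by simp
      ultimately show ?thesis
        using f_nonneg[OF est win y]
        by (simp add: path_density_def plugin_likelihood_Suc[OF n] ennreal_mult
            flip: mult.assoc split: split_indicator)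
    qed
    then have "(\<integral>\<^sup>+y. path_density \<theta> e (Suc n) (x(Suc n := y)) *
        indicator {x. B (restrict x {1..n})} (x(Suc n := y)) \<partial>M) =
      (\<integral>\<^sup>+y. path_density \<theta> e n x * indicator {x. B x} x *
        ennreal (f (estimate e n x) (window p x (Suc n)) y) \<partial>M)"
      by (intro nn_integral_cong) simp
    also have "\<dots> = path_density \<theta> e n x * indicator {x. B x} x *
      (\<integral>\<^sup>+y. ennreal (f (estimate e n x) (window p x (Suc n)) y) \<partial>M)"
    proof (rule nn_integral_cmult)
      have "(\<lambda>y. (estimate e n x, window p x (Suc n), y))
          \<in> measurable M (Par \<Otimes>\<^sub>M (PiM {..<p} (\<lambda>_. M) \<Otimes>\<^sub>M M))"
        using est win by (intro measurable_Pair) auto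
      from measurable_compose[OF this f_measurable]
      show "(\<lambda>y. ennreal (f (estimate e n x) (window p x (Suc n)) y)) \<in> borel_measurable M"
        by simp
    qed
    also have "\<dots> = path_density \<theta> e n x * indicator {x. B x} x"
      using f_integral[OF est win] by simp
    finally show "(\<integral>\<^sup>+y. path_density \<theta> e (Suc n) (x(Suc n := y)) *
        indicator {x. B (restrict x {1..n})} (x(Suc n := y)) \<partial>M) =
      path_density \<theta> e n x * indicator {x. B x} x" .
  qed
  finally show ?thesis .
qed

lemma nn_integral_path_density:
  assumes "\<theta> \<in> space Par" "\<And>t. p \<le> t \<Longrightarrow> estimator M Par t (e t)" "p \<le> n"
  shows "(\<integral>\<^sup>+x. path_density \<theta> e n x \<partial>PiM {1..n} (\<lambda>_. M)) =
    (\<integral>\<^sup>+x. path_density \<theta> e p x \<partial>PiM {1..p} (\<lambda>_. M))"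
  using assms(3)
proof (induction n rule: dec_induct)
  case (step n)
  with nn_integral_path_density_Suc[OF assms(1,2), of n "\<lambda>_. True"] show ?case by simp
qed simp

section \<open>Comparison of the two densities on the crossing event\<close>

text \<open>Starting at \<open>p + 1\<close> makes the event empty for \<open>n = p\<close>, the
  base of the induction. The events grow with \<open>n\<close>, and the increment at
  \<open>Suc n\<close> consists of the paths that cross there for the first time.\<close>

definition crossed :: "(nat \<Rightarrow> (nat \<Rightarrow> 'a) \<Rightarrow> 'b) \<Rightarrow> 'b \<Rightarrow> real \<Rightarrow> nat \<Rightarrow> (nat \<Rightarrow> 'a) \<Rightarrow> bool" where
  "crossed e \<theta> c n x \<longleftrightarrow> (\<exists>T\<in>{p + 1..n}. ennreal c < M_process p f e \<theta> x T)"

lemma crossed_cong: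
  assumes "\<And>s. 1 \<le> s \<Longrightarrow> s \<le> n \<Longrightarrow> x s = y s"
  shows "crossed e \<theta> c n x = crossed e \<theta> c n y"
  unfolding crossed_def by (intro bex_cong refl) (simp add: M_process_cong[of n x y] assms)

lemma crossed_Suc:
  assumes "p \<le> n"
  shows "crossed e \<theta> c (Suc n) x \<longleftrightarrow>
    crossed e \<theta> c n x \<or> ennreal c < M_process p f e \<theta> x (Suc n)"
proof -
  have "{p + 1..Suc n} = insert (Suc n) {p + 1..n}" using assms by auto
  then show ?thesis by (auto simp: crossed_def)
qed

lemma crossed_measurable:
  assumes "\<theta> \<in> space Par" and "\<And>t. p \<le> t \<Longrightarrow> estimator M Par t (e t)"
  shows "Measurable.pred (PiM {1..n} (\<lambda>_. M)) (crossed e \<theta> c n)"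
proof -
  have "(\<lambda>x. M_process p f e \<theta> x T) \<in> borel_measurable (PiM {1..n} (\<lambda>_. M))"
    if T: "T \<in> {p + 1..n}" for T
  proof -
    have [measurable]: "(\<lambda>x. plugin_likelihood p f e x T) \<in> borel_measurable (PiM {1..n} (\<lambda>_. M))"
      "(\<lambda>x. cond_likelihood p f \<theta> x T) \<in> borel_measurable (PiM {1..n} (\<lambda>_. M))"
      unfolding cond_likelihood_eq_plugin using T
      by (intro plugin_likelihood_measurable assms const_estimator; simp)+
    have eq: "(\<lambda>x. M_process p f e \<theta> x T) = (\<lambda>x. likelihood_ratio
        (plugin_likelihood p f e x T) (cond_likelihood p f \<theta> x T))"
      using T by (simp add: fun_eq_iff M_process_eq)
    show ?thesis
      unfolding eq likelihood_ratio_def by measurable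
  qed
  then show ?thesis
    unfolding crossed_def[abs_def]
    by (intro pred_intros_finite) auto
qed

text \<open>Induction on \<open>n\<close>, splitting by whether the path has crossed by time
  \<open>n\<close>. If so, the last observation integrates out and the induction hypothesis applies;
  if not, the ratio exceeds \<open>c\<close> at \<open>Suc n\<close> and the densities compare
  pointwise.\<close>

lemma crossed_density_bound:
  assumes \<theta>: "\<theta> \<in> space Par" and e: "\<And>t. p \<le> t \<Longrightarrow> estimator M Par t (e t)"
    and c: "0 \<le> c" and n: "p \<le> n"
  shows "ennreal c * (\<integral>\<^sup>+x. path_density \<theta> (\<lambda>_ _. \<theta>) n x * indicator {x. crossed e \<theta> c n x} x
            \<partial>PiM {1..n} (\<lambda>_. M))
    \<le> (\<integral>\<^sup>+x. path_density \<theta> e n x * indicator {x. crossed e \<theta> c n x} x \<partial>PiM {1..n} (\<lambda>_. M))"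
  using n
proof (induction n rule: dec_induct)
  case base
  then show ?case by (simp add: crossed_def)
next
  case (step n)
  let ?M = "PiM {1..Suc n} (\<lambda>_. M)"
  let ?g = "path_density \<theta> (\<lambda>_ _. \<theta>) (Suc n)" and ?h = "path_density \<theta> e (Suc n)"
  \<comment> \<open>Written through \<open>restrict\<close> to match the form in which the last
    observation is integrated out; \<open>old\<close> shows that this is crossing by time
    \<open>n\<close>.\<close>
  let ?old = "{x. crossed e \<theta> c n (restrict x {1..n})}"
  let ?all = "{x. crossed e \<theta> c (Suc n) x}"
  let ?new = "?all - ?old"
  have old: "crossed e \<theta> c n (restrict x {1..n}) = crossed e \<theta> c n x" for x
    by (rule crossed_cong) simp
  have res: "(\<lambda>x. restrict x {1..n}) \<in> measurable ?M (PiM {1..n} (\<lambda>_. M))"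
    by (rule measurable_restrict_subset) auto
  have [measurable]: "Measurable.pred ?M (\<lambda>x. crossed e \<theta> c n (restrict x {1..n}))"
    by (rule measurable_compose[OF res crossed_measurable[OF \<theta> e]])
  have [measurable]: "Measurable.pred ?M (crossed e \<theta> c (Suc n))"
    by (rule crossed_measurable[OF \<theta> e])
  have [measurable]: "?g \<in> borel_measurable ?M" "?h \<in> borel_measurable ?M"
    using step.hyps by (intro path_density_measurable \<theta> e const_estimator; simp)+
  \<comment> \<open>\<open>?old\<close> lies inside \<open>?all\<close>, so \<open>?all\<close> is
    the disjoint union of \<open>?old\<close> and \<open>?new\<close>. The density \<open>d\<close>
    is left open to serve both \<open>?g\<close> and \<open>?h\<close>.\<close>
  have split: "(\<integral>\<^sup>+x. d x * indicator ?all x \<partial>?M) =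
      (\<integral>\<^sup>+x. d x * indicator ?old x \<partial>?M) + (\<integral>\<^sup>+x. d x * indicator ?new x \<partial>?M)"
    if [measurable]: "d \<in> borel_measurable ?M" for d
  proof -
    have "(\<integral>\<^sup>+x. d x * indicator ?all x \<partial>?M) =
      (\<integral>\<^sup>+x. d x * indicator ?old x + d x * indicator ?new x \<partial>?M)"
      by (intro nn_integral_cong)
        (use step in \<open>auto simp: old crossed_Suc simp del: One_nat_def split: split_indicator\<close>)
    also have "\<dots> = (\<integral>\<^sup>+x. d x * indicator ?old x \<partial>?M) + (\<integral>\<^sup>+x. d x * indicator ?new x \<partial>?M)"
      by (intro nn_integral_add) measurable
    finally show ?thesis .
  qed
  have "ennreal c * (\<integral>\<^sup>+x. ?g x * indicator ?new x \<partial>?M) =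
      (\<integral>\<^sup>+x. ennreal c * (?g x * indicator ?new x) \<partial>?M)"
    by (intro nn_integral_cmult[symmetric]) measurable
  also have "\<dots> \<le> (\<integral>\<^sup>+x. ?h x * indicator ?new x \<partial>?M)"
  proof (rule nn_integral_mono)
    fix x assume x: "x \<in> space ?M"
    show "ennreal c * (?g x * indicator ?new x) \<le> ?h x * indicator ?new x"
    proof (cases "x \<in> ?new")
      case True
      \<comment> \<open>A path in \<open>?new\<close> has no earlier crossing, so it crosses at time
        \<open>Suc n\<close> itself.\<close>
      then have "ennreal c < M_process p f e \<theta> x (Suc n)"
        using step by (auto simp: old crossed_Suc simp del: One_nat_def)
      moreover have "0 \<le> plugin_likelihood p f e x (Suc n)"
        "0 \<le> plugin_likelihood p f (\<lambda>_ _. \<theta>) x (Suc n)"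
        using plugin_likelihood_nonneg[OF x] e const_estimator[OF \<theta>] by auto
      ultimately have "c * plugin_likelihood p f (\<lambda>_ _. \<theta>) x (Suc n) \<le>
          plugin_likelihood p f e x (Suc n)"
        using step c
        by (intro likelihood_ratio_less_imp) (auto simp: M_process_eq cond_likelihood_eq_plugin)
      \<comment> \<open>The common initial factor turns the comparison of likelihoods into one of
        joint densities.\<close>
      then have "f0 \<theta> (window p x (p + 1)) * (c * plugin_likelihood p f (\<lambda>_ _. \<theta>) x (Suc n)) \<le>
          f0 \<theta> (window p x (p + 1)) * plugin_likelihood p f e x (Suc n)"
        using initial_density_nonneg[OF x \<theta>] step by (intro mult_left_mono) auto
      then show ?thesis
        using True c
        by (simp add: path_density_def ennreal_mult'[symmetric] mult_ac ennreal_leI)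
    qed simp
  qed
  finally have new: "ennreal c * (\<integral>\<^sup>+x. ?g x * indicator ?new x \<partial>?M)
      \<le> (\<integral>\<^sup>+x. ?h x * indicator ?new x \<partial>?M)" .
  \<comment> \<open>Stated for any \<open>e'\<close>, because it is applied to the plug-in density
    and to the density at the constant \<open>\<theta>\<close>.\<close>
  have integrate_out: "(\<integral>\<^sup>+x. path_density \<theta> e' (Suc n) x * indicator ?old x \<partial>?M) =
      (\<integral>\<^sup>+x. path_density \<theta> e' n x * indicator {x. crossed e \<theta> c n x} x \<partial>PiM {1..n} (\<lambda>_. M))"
    if "\<And>t. p \<le> t \<Longrightarrow> estimator M Par t (e' t)" for e'
    by (rule nn_integral_path_density_Suc[OF \<theta> that step.hyps(1) crossed_measurable[OF \<theta> e]])
  have "ennreal c * (\<integral>\<^sup>+x. ?g x * indicator ?old x \<partial>?M)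
      \<le> (\<integral>\<^sup>+x. ?h x * indicator ?old x \<partial>?M)"
    by (subst (1 2) integrate_out) (rule const_estimator[OF \<theta>] e step.IH; assumption?)+
  then show ?case
    unfolding split[OF \<open>?g \<in> borel_measurable ?M\<close>] split[OF \<open>?h \<in> borel_measurable ?M\<close>]
      distrib_left
    using new by (rule add_mono)
qed

end

section \<open>Transfer to the observed series and Ville's inequality\<close>

context autoregressive_series
begin

lemma space_P: "\<theta> \<in> space Par \<Longrightarrow> space (P \<theta>) = space \<Omega>"
  using sets_P by (rule sets_eq_imp_space_eq)

lemma observations_in_space:
  "\<omega> \<in> space \<Omega> \<Longrightarrow> (\<lambda>t\<in>{1..n}. X t \<omega>) \<in> space (PiM {1..n} (\<lambda>_. M))"
  using measurable_space[OF X_measurable] by (auto simp: space_PiM)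

text \<open>The full data path need not be a point of a finite product, but its restriction to
  \<open>{1..T}\<close> is, and it has the same likelihood.\<close>

lemma plugin_likelihood_observations_nonneg:
  assumes "\<omega> \<in> space \<Omega>" "\<And>t. p \<le> t \<Longrightarrow> estimator M Par t (e t)"
  shows "0 \<le> plugin_likelihood p f e (\<lambda>t. X t \<omega>) T"
proof -
  have "plugin_likelihood p f e (\<lambda>t. X t \<omega>) T = plugin_likelihood p f e (\<lambda>t\<in>{1..T}. X t \<omega>) T"
    by (rule plugin_likelihood_cong[where n = T]) auto
  then show ?thesis
    using plugin_likelihood_nonneg[OF observations_in_space[OF assms(1)] assms(2), of T T] by simp
qed

text \<open>The mass does not depend on \<open>n\<close> or \<open>e\<close>, so one case decides
  it: at time \<open>Suc p\<close> with constant \<open>\<theta>\<close> it is the mass of the law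
  of the observations. Using that law avoids reindexing the normalisation of \<open>f0\<close> from
  \<open>{..<p}\<close> to \<open>{1..p}\<close>; \<open>Suc p\<close> is the first time for which
  \<open>joint_density\<close> applies.\<close>

lemma nn_integral_path_density_eq_1:
  assumes \<theta>: "\<theta> \<in> space Par" and e: "\<And>t. p \<le> t \<Longrightarrow> estimator M Par t (e t)" and n: "p \<le> n"
  shows "(\<integral>\<^sup>+x. path_density \<theta> e n x \<partial>PiM {1..n} (\<lambda>_. M)) = 1"
proof -
  interpret prob_space "P \<theta>" by (rule prob_space_P[OF \<theta>])
  let ?M = "PiM {1..Suc p} (\<lambda>_. M)"
  have D: "distributed (P \<theta>) ?M (\<lambda>\<omega>. \<lambda>t\<in>{1..Suc p}. X t \<omega>) (path_density \<theta> (\<lambda>_ _. \<theta>) (Suc p))"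
    using joint_density[OF \<theta>, of "Suc p"]
    by (simp add: path_density_def[abs_def] cond_likelihood_eq_plugin)
  have "(\<integral>\<^sup>+x. path_density \<theta> (\<lambda>_ _. \<theta>) (Suc p) x \<partial>?M) =
      emeasure (P \<theta>) ((\<lambda>\<omega>. \<lambda>t\<in>{1..Suc p}. X t \<omega>) -` space ?M \<inter> space (P \<theta>))"
    unfolding distributed_emeasure[OF D sets.top] by (auto intro!: nn_integral_cong)
  also have "(\<lambda>\<omega>. \<lambda>t\<in>{1..Suc p}. X t \<omega>) -` space ?M \<inter> space (P \<theta>) = space (P \<theta>)"
    using observations_in_space[of _ "Suc p"] by (auto simp: space_P[OF \<theta>])
  finally have "(\<integral>\<^sup>+x. path_density \<theta> (\<lambda>_ _. \<theta>) (Suc p) x \<partial>?M) = 1"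
    by (simp add: emeasure_space_1)
  moreover have "(\<integral>\<^sup>+x. path_density \<theta> (\<lambda>_ _. \<theta>) (Suc p) x \<partial>?M) =
      (\<integral>\<^sup>+x. path_density \<theta> (\<lambda>_ _. \<theta>) p x \<partial>PiM {1..p} (\<lambda>_. M))"
    by (rule nn_integral_path_density) (auto intro: \<theta> const_estimator)
  ultimately show ?thesis
    using nn_integral_path_density[OF \<theta> e n] path_density_start[of \<theta> e _ "\<lambda>_ _. \<theta>"] by simp
qed

text \<open>The event is a preimage under the first \<open>n\<close> observations, so its
  probability is an integral of the density at \<open>\<theta>\<close>. The plug-in integral that
  bounds it is at most the total mass one.\<close>

lemma crossed_event:
  assumes \<theta>: "\<theta> \<in> space Par" and e: "\<And>t. p \<le> t \<Longrightarrow> estimator M Par t (e t)"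
    and c: "0 \<le> c" and n: "p < n"
  shows "{\<omega> \<in> space \<Omega>. crossed e \<theta> c n (\<lambda>t. X t \<omega>)} \<in> sets (P \<theta>)" (is ?meas)
    and "ennreal c * emeasure (P \<theta>) {\<omega> \<in> space \<Omega>. crossed e \<theta> c n (\<lambda>t. X t \<omega>)} \<le> 1" (is ?bound)
proof -
  let ?M = "PiM {1..n} (\<lambda>_. M)" and ?X = "\<lambda>\<omega>. \<lambda>t\<in>{1..n}. X t \<omega>"
  let ?A = "{x \<in> space ?M. crossed e \<theta> c n x}"
  have D: "distributed (P \<theta>) ?M ?X (path_density \<theta> (\<lambda>_ _. \<theta>) n)"
    using joint_density[OF \<theta> n] by (simp add: path_density_def[abs_def] cond_likelihood_eq_plugin)
  have A: "?A \<in> sets ?M"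
    using crossed_measurable[OF \<theta> e] by measurable
  have restr: "crossed e \<theta> c n (?X \<omega>) = crossed e \<theta> c n (\<lambda>t. X t \<omega>)" for \<omega>
    by (rule crossed_cong) simp
  have eq: "{\<omega> \<in> space \<Omega>. crossed e \<theta> c n (\<lambda>t. X t \<omega>)} = ?X -` ?A \<inter> space (P \<theta>)"
    using observations_in_space restr by (auto simp: space_P[OF \<theta>])
  show ?meas
    unfolding eq by (rule measurable_sets[OF distributed_measurable[OF D] A])
  have "ennreal c * emeasure (P \<theta>) {\<omega> \<in> space \<Omega>. crossed e \<theta> c n (\<lambda>t. X t \<omega>)} =
      ennreal c * (\<integral>\<^sup>+x. path_density \<theta> (\<lambda>_ _. \<theta>) n x * indicator {x. crossed e \<theta> c n x} x \<partial>?M)"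
    unfolding eq distributed_emeasure[OF D A]
    by (intro arg_cong[where f = "\<lambda>x. ennreal c * x"] nn_integral_cong) (simp split: split_indicator)
  also have "\<dots> \<le> (\<integral>\<^sup>+x. path_density \<theta> e n x * indicator {x. crossed e \<theta> c n x} x \<partial>?M)"
    by (rule crossed_density_bound[OF \<theta> e c]) (use n in auto)
  also have "\<dots> \<le> (\<integral>\<^sup>+x. path_density \<theta> e n x \<partial>?M)"
    by (rule nn_integral_mono) (simp split: split_indicator)
  also have "\<dots> = 1"
    by (rule nn_integral_path_density_eq_1[OF \<theta> e]) (use n in auto)
  finally show ?bound .
qed

text \<open>The bound for crossing by a finite time is uniform in that time, and continuity along
  increasing events carries it to the infinite horizon.\<close>

lemma ville_inequality:
  assumes \<theta>: "\<theta> \<in> space Par" and e: "\<And>t. p \<le> t \<Longrightarrow> estimator M Par t (e t)"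
    and c: "0 < c"
  defines "E \<equiv> {\<omega> \<in> space \<Omega>. \<exists>T>p. ennreal c < M_process p f e \<theta> (\<lambda>t. X t \<omega>) T}"
  shows "E \<in> sets (P \<theta>)" and "measure (P \<theta>) E \<le> 1 / c"
proof -
  interpret prob_space "P \<theta>" by (rule prob_space_P[OF \<theta>])
  \<comment> \<open>The shift by \<open>Suc p\<close> keeps every time horizon above
    \<open>p\<close>, as \<open>crossed_event\<close> requires.\<close>
  let ?E = "\<lambda>k. {\<omega> \<in> space \<Omega>. crossed e \<theta> c (Suc (p + k)) (\<lambda>t. X t \<omega>)}"
  have sets: "?E k \<in> sets (P \<theta>)" for k
    by (rule crossed_event[OF \<theta> e]) (use c in auto)
  have bound: "prob (?E k) \<le> 1 / c" for k
  proof -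
    have "ennreal c * emeasure (P \<theta>) (?E k) \<le> 1"
      by (rule crossed_event[OF \<theta> e]) (use c in auto)
    then have "ennreal (c * prob (?E k)) \<le> ennreal 1"
      using c by (simp add: emeasure_eq_measure ennreal_mult)
    then show ?thesis
      using c by (subst (asm) ennreal_le_iff) (auto simp: field_simps)
  qed
  have un: "E = (\<Union>k. ?E k)"
  proof (intro set_eqI iffI)
    fix \<omega> assume "\<omega> \<in> E"
    then obtain T where "\<omega> \<in> space \<Omega>" "p < T" "ennreal c < M_process p f e \<theta> (\<lambda>t. X t \<omega>) T"
      by (auto simp: E_def)
    \<comment> \<open>The index \<open>T\<close> is large enough because
      \<open>T \<le> Suc (p + T)\<close>.\<close>
    then have "\<omega> \<in> ?E T" by (auto simp: crossed_def)
    then show "\<omega> \<in> (\<Union>k. ?E k)" by blast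
  qed (auto simp: E_def crossed_def Suc_le_eq)
  show "E \<in> sets (P \<theta>)" unfolding un using sets by auto
  have "incseq ?E"
    by (rule incseq_SucI) (auto simp: crossed_Suc)
  then have "(\<lambda>k. prob (?E k)) \<longlonglongrightarrow> prob E"
    unfolding un using sets by (intro finite_Lim_measure_incseq) auto
  then show "prob E \<le> 1 / c"
    by (rule LIMSEQ_le_const2) (use bound in auto)
qed

section \<open>From a fixed null parameter to the maximum likelihood estimate\<close>

text \<open>The parameter \<open>\<theta>\<close> is one of the competitors of the maximiser, so
  passing to the maximiser can only enlarge the denominator. The bound holds path by path, also
  where the likelihood at \<open>\<theta>\<close> vanishes.\<close>

lemma N_process_le_M_process:
  assumes \<theta>: "\<theta> \<in> \<Theta>0" "\<Theta>0 \<subseteq> space Par" and \<omega>: "\<omega> \<in> space \<Omega>"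
    and e: "\<And>t. p \<le> t \<Longrightarrow> estimator M Par t (e t)" and T: "p < T"
    and ml: "estimate \<theta>tilde T (\<lambda>t. X t \<omega>) \<in> max_likelihood_set p f \<Theta>0 (\<lambda>t. X t \<omega>) T"
  shows "N_process p f e \<theta>tilde (\<lambda>t. X t \<omega>) T \<le> M_process p f e \<theta> (\<lambda>t. X t \<omega>) T"
proof -
  have "0 \<le> plugin_likelihood p f e (\<lambda>t. X t \<omega>) T"
    by (rule plugin_likelihood_observations_nonneg[OF \<omega> e])
  moreover have "0 \<le> cond_likelihood p f \<theta> (\<lambda>t. X t \<omega>) T"
    unfolding cond_likelihood_eq_plugin using \<theta>
    by (intro plugin_likelihood_observations_nonneg[OF \<omega>] const_estimator) auto
  ultimately show ?thesis
    using T \<theta> ml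
    by (auto simp: N_process_def M_process_eq max_likelihood_set_def intro!: likelihood_ratio_antimono)
qed

end

theorem proposition3:
  fixes M :: "'a measure" and p :: nat and Par :: "'b measure"
    and f0 :: "'b \<Rightarrow> (nat \<Rightarrow> 'a) \<Rightarrow> real" and f :: "'b \<Rightarrow> (nat \<Rightarrow> 'a) \<Rightarrow> 'a \<Rightarrow> real"
    and \<Omega> :: "'w measure" and P :: "'b \<Rightarrow> 'w measure" and X :: "nat \<Rightarrow> 'w \<Rightarrow> 'a"
    and \<Theta>0 :: "'b set"
    and \<theta>hat \<theta>tilde :: "nat \<Rightarrow> (nat \<Rightarrow> 'a) \<Rightarrow> 'b"
    and \<alpha> :: real
  assumes "autoregressive_series M p Par f0 f \<Omega> P X"
    and "\<Theta>0 \<subseteq> space Par" and "\<Theta>0 \<noteq> {}"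
    and "\<And>T. p \<le> T \<Longrightarrow> estimator M Par T (\<theta>hat T)"
    and "\<And>T. p + 1 \<le> T \<Longrightarrow> estimator M Par T (\<theta>tilde T)"
    and "\<And>T \<omega>. p + 1 \<le> T \<Longrightarrow> \<omega> \<in> space \<Omega> \<Longrightarrow>
          estimate \<theta>tilde T (\<lambda>t. X t \<omega>) \<in> max_likelihood_set p f \<Theta>0 (\<lambda>t. X t \<omega>) T"
    and "0 < \<alpha>" and "\<alpha> < 1"
  shows "(SUP \<theta>\<in>\<Theta>0. measure (P \<theta>)
            {\<omega> \<in> space \<Omega>. (SUP T. N_process p f \<theta>hat \<theta>tilde (\<lambda>t. X t \<omega>) T) \<ge> ennreal (1 / \<alpha>)}) \<le> \<alpha>"
proof (rule cSUP_least[OF assms(3)])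
  interpret autoregressive_series M p Par f0 f \<Omega> P X by (rule assms(1))
  fix \<theta> assume \<theta>0: "\<theta> \<in> \<Theta>0"
  then have \<theta>: "\<theta> \<in> space Par" using assms(2) by auto
  interpret prob_space "P \<theta>" by (rule prob_space_P[OF \<theta>])
  let ?N = "\<lambda>\<omega>. N_process p f \<theta>hat \<theta>tilde (\<lambda>t. X t \<omega>)"
  let ?S = "{\<omega> \<in> space \<Omega>. ennreal (1 / \<alpha>) \<le> (SUP T. ?N \<omega> T)}"
  \<comment> \<open>The supremum need not be attained, hence levels strictly below \<open>1 / \<alpha>\<close>; levels of at least
    \<open>1\<close> cannot be exceeded at a time \<open>T \<le> p\<close>.\<close>
  have below: "prob ?S \<le> a" if a: "\<alpha> < a" "a < 1" for a
  proof -
    let ?E = "{\<omega> \<in> space \<Omega>. \<exists>T>p. ennreal (1 / a) < M_process p f \<theta>hat \<theta> (\<lambda>t. X t \<omega>) T}"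
    have pos: "0 < 1 / a" using assms(7) a by simp
    have E: "?E \<in> sets (P \<theta>)" "prob ?E \<le> 1 / (1 / a)"
      by (rule ville_inequality[OF \<theta> assms(4) pos]; assumption)+
    have "?S \<subseteq> ?E"
    proof
      fix \<omega> assume "\<omega> \<in> ?S"
      then have \<omega>: "\<omega> \<in> space \<Omega>" and S: "ennreal (1 / \<alpha>) \<le> (SUP T. ?N \<omega> T)" by auto
      have "ennreal (1 / a) < ennreal (1 / \<alpha>)"
        using assms(7) a by (intro ennreal_lessI) (auto simp: field_simps)
      also note S
      finally obtain T where T: "ennreal (1 / a) < ?N \<omega> T"
        by (auto simp: less_SUP_iff)
      have "p < T"
      proof (rule ccontr)
        assume "\<not> p < T"
        with T have "ennreal (1 / a) < ennreal 1" by (simp add: N_process_def)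
        then show False using assms(7) a by (simp add: ennreal_less_iff field_simps del: ennreal_1)
      qed
      moreover have "?N \<omega> T \<le> M_process p f \<theta>hat \<theta> (\<lambda>t. X t \<omega>) T"
        by (rule N_process_le_M_process[OF \<theta>0 assms(2) \<omega> assms(4) \<open>p < T\<close> assms(6)[OF _ \<omega>]])
          (use \<open>p < T\<close> in simp_all)
      ultimately show "\<omega> \<in> ?E" using T \<omega> by auto
    qed
    from finite_measure_mono[OF this E(1)] E(2) show ?thesis by simp
  qed
  \<comment> \<open>Let \<open>a\<close> decrease to \<open>\<alpha>\<close>; the interval of
    admissible \<open>a\<close> is nonempty since \<open>\<alpha> < 1\<close>.\<close>
  show "prob ?S \<le> \<alpha>"
    by (rule dense_ge_bounded[OF assms(8)]) (rule below)
qed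

end
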